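(* Let $F=\mathbb{F}_q$ with $q=2^r$ and let $f:F\to F$ be a pseudo-planar function. Then the bases $$B_\infty=\{e_w\mid w\in F\},\qquad B_m=\{b_{m,v}\mid v\in F\}\ (m\in F),\qquad b_{m,v}=\frac1{\sqrt q}\sum_{w\in F}\omega^{{\rm Tr}(\hat m(\hat w^2+2f(\hat w))+2\hat v\hat w)}e_w,$$ form a complete set of mutually unbiased bases of $\mathbb{C}^q$.
   Context: A function $f:F\to F$ ($F$ of characteristic $2$) is pseudo-planar if for each $a\in F^*$ the map $x\mapsto f(x+a)+f(x)+ax$ is a permutation of $F$. $\omega\in\mathbb{C}$ is a primitive $4$th root of unity and $\{e_w\}_{w\in F}$ the standard basis of $\mathbb{C}^q$. $R=GR(4^r)$ is the Galois ring of characteristic $4$ and order $4^r$ ($R/2R\cong F$), $\mathcal{T}=\{0\}\cup C$ its Teichmüller set ($C$ the cyclic subgroup of order $2^r-1$ of $R^*$), and $\hat u\in\mathcal{T}$ the Teichmüller lift of $u\in F$; $f$ is regarded as a function $\mathcal{T}\to\mathcal{T}$ via $f(\hat w)=\widehat{f(w)}$. For $x=a+2b$ ($a,b\in\mathcal{T}$), ${\rm Tr}(x)=\sum_{i=0}^{r-1}(a^{2^i}+2b^{2^i})\in\mathbb{Z}_4$. A complete set of MUBs of $\mathbb{C}^q$ is a set of $q+1$ orthonormal bases with $|(x,y)|^2=1/q$ for $x,y$ in distinct bases. *)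

theory Defs
  imports "HOL-Analysis.Analysis"
begin

definition pseudo_planar :: "('a::field \<Rightarrow> 'a) \<Rightarrow> bool" where
  "pseudo_planar f \<longleftrightarrow> (\<forall>a. a \<noteq> 0 \<longrightarrow> bij (\<lambda>x. f (x + a) + f x + a * x))"


subsection \<open>The Galois ring of characteristic 4\<close>

text \<open>A Galois ring is a finite commutative ring with identity whose zero divisors, together
  with 0, form the principal ideal generated by a prime number \<open>p\<close>. Its characteristic and
  order determine it up to isomorphism.\<close>

definition galois_ring :: "'r::{comm_ring_1,finite} itself \<Rightarrow> bool" where
  "galois_ring _ \<longleftrightarrow>
     (\<exists>p::nat. prime p \<and> {x::'r. \<exists>y. y \<noteq> 0 \<and> x * y = 0} = {of_nat p * z |z. True})"

definition galois_ring_4 :: "'r::{comm_ring_1,finite} itself \<Rightarrow> nat \<Rightarrow> bool" where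
  "galois_ring_4 R r \<longleftrightarrow> galois_ring R \<and> CHAR('r) = 4 \<and> CARD('r) = 4 ^ r"

text \<open>An isomorphism \<open>R/2R \<cong> F\<close>, given as a surjective ring homomorphism \<open>R \<rightarrow> F\<close> with
  kernel \<open>2R\<close>.\<close>

definition residue_map :: "('r::comm_ring_1 \<Rightarrow> 'a::field) \<Rightarrow> bool" where
  "residue_map \<pi> \<longleftrightarrow>
     \<pi> 1 = 1 \<and> (\<forall>x y. \<pi> (x + y) = \<pi> x + \<pi> y) \<and> (\<forall>x y. \<pi> (x * y) = \<pi> x * \<pi> y) \<and>
     surj \<pi> \<and> {x. \<pi> x = 0} = {2 * z |z. True}"

text \<open>In a finite ring every unit has finite order, so the cyclic subgroup that it generates
  consists of its powers with natural exponent.\<close>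

definition cyclic_unit_subgroup :: "'r::{comm_ring_1,finite} set \<Rightarrow> bool" where
  "cyclic_unit_subgroup C \<longleftrightarrow> (\<exists>\<xi>. \<xi> dvd 1 \<and> C = {\<xi> ^ i |i::nat. True})"

definition teich_group :: "nat \<Rightarrow> 'r::{comm_ring_1,finite} set" where
  "teich_group r = (THE C. cyclic_unit_subgroup C \<and> card C = 2 ^ r - 1)"

definition teich_set :: "nat \<Rightarrow> 'r::{comm_ring_1,finite} set" where
  "teich_set r = {0} \<union> teich_group r"

definition teich_lift :: "nat \<Rightarrow> ('r::{comm_ring_1,finite} \<Rightarrow> 'a::field) \<Rightarrow> 'a \<Rightarrow> 'r" where
  "teich_lift r \<pi> u = (THE t. t \<in> teich_set r \<and> \<pi> t = u)"

text \<open>The generalised trace. Its values lie in the prime subring of \<open>R\<close>, which is the copy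
  of \<open>\<int>\<^sub>4\<close> inside \<open>R\<close>.\<close>

definition gr_trace :: "nat \<Rightarrow> 'r::{comm_ring_1,finite} \<Rightarrow> 'r" where
  "gr_trace r x =
     (THE s. \<exists>a\<in>teich_set r. \<exists>b\<in>teich_set r.
        x = a + 2 * b \<and> s = (\<Sum>i<r. a ^ (2 ^ i) + 2 * b ^ (2 ^ i)))"

text \<open>The representative in \<open>{0,1,2,3}\<close> of an element of the prime subring.\<close>

definition z4_rep :: "'r::comm_ring_1 \<Rightarrow> nat" where
  "z4_rep t = (THE k. k < 4 \<and> of_nat k = t)"


subsection \<open>Mutually unbiased bases\<close>

definition primitive_root_unity :: "nat \<Rightarrow> complex \<Rightarrow> bool" where
  "primitive_root_unity n \<omega> \<longleftrightarrow> \<omega> ^ n = 1 \<and> (\<forall>k. 0 < k \<and> k < n \<longrightarrow> \<omega> ^ k \<noteq> 1)"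

text \<open>The library inner product on \<^typ>\<open>complex ^ 'n\<close> is real-valued; this is the
  Hermitian one.\<close>

definition herm :: "complex ^ 'n \<Rightarrow> complex ^ 'n \<Rightarrow> complex" where
  "herm x y = (\<Sum>i\<in>UNIV. x $ i * cnj (y $ i))"

definition orthonormal_basis :: "(complex ^ 'n) set \<Rightarrow> bool" where
  "orthonormal_basis B \<longleftrightarrow>
     (\<forall>x\<in>B. \<forall>y\<in>B. herm x y = (if x = y then 1 else 0)) \<and> vec.span B = UNIV"

definition complete_mubs :: "(complex ^ 'n) set set \<Rightarrow> bool" where
  "complete_mubs \<B> \<longleftrightarrow>
     card \<B> = CARD('n) + 1 \<and> (\<forall>B\<in>\<B>. orthonormal_basis B) \<and>
     (\<forall>B\<in>\<B>. \<forall>B'\<in>\<B>. B \<noteq> B' \<longrightarrow>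
        (\<forall>x\<in>B. \<forall>y\<in>B'. (cmod (herm x y))\<^sup>2 = 1 / real CARD('n)))"

definition basis_inf :: "(complex ^ 'a::finite) set" where
  "basis_inf = {axis w 1 |w. True}"

text \<open>Here \<open>f\<close> is transported to the Teichmueller set: \<open>f (teich_lift w)\<close> is
  \<open>teich_lift (f w)\<close>.\<close>

definition mub_vec ::
  "nat \<Rightarrow> ('r::{comm_ring_1,finite} \<Rightarrow> 'a::{field,finite}) \<Rightarrow> complex \<Rightarrow> ('a \<Rightarrow> 'a) \<Rightarrow> 'a \<Rightarrow> 'a \<Rightarrow> complex ^ ('a::{field,finite})"
  where
  "mub_vec r \<pi> \<omega> f m v =
     (1 / complex_of_real (sqrt (real CARD('a)))) *s
     (\<Sum>w\<in>UNIV.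
        \<omega> ^ z4_rep (gr_trace r
              (teich_lift r \<pi> m * ((teich_lift r \<pi> w)\<^sup>2 + 2 * teich_lift r \<pi> (f w))
               + 2 * teich_lift r \<pi> v * teich_lift r \<pi> w)) *s axis w 1)"

definition mub_basis ::
  "nat \<Rightarrow> ('r::{comm_ring_1,finite} \<Rightarrow> 'a::{field,finite}) \<Rightarrow> complex \<Rightarrow> ('a \<Rightarrow> 'a) \<Rightarrow> 'a \<Rightarrow> (complex ^ ('a::{field,finite})) set"
  where
  "mub_basis r \<pi> \<omega> f m = {mub_vec r \<pi> \<omega> f m v |v. True}"

end

theory Submission
  imports Defs "HOL-Number_Theory.Cong" "HOL-Algebra.Multiplicative_Group"
begin

text \<open>Write \<open>q = 2 ^ r\<close>. Since \<open>x\<^sup>2\<close> modulo 4 depends only on \<open>x\<close> modulo 2, the Teichmueller lift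
  of \<open>\<pi> x\<close> is \<open>x ^ q\<close>, and lifts add up to a carry: the lift of \<open>(u + v)\<^sup>2\<close> is the sum of the lifts
  of \<open>u\<^sup>2\<close> and \<open>v\<^sup>2\<close> plus twice the lift of \<open>u v\<close>. The inner product of two vectors of different
  bases \<open>B_m\<close>, \<open>B_m'\<close> is \<open>S / q\<close> with \<open>S\<close> a sum of values of the additive character
  \<open>x \<mapsto> \<omega> ^ Tr x\<close>. Expanding \<open>|S|\<^sup>2\<close> as a double sum over \<open>w + a\<close> and \<open>w\<close>, the carry supplies exactly
  the summand \<open>a w\<close> that turns \<open>f (w + a) + f w\<close> into a permutation of \<open>F\<close>, so only \<open>a = 0\<close>
  contributes, and \<open>|S|\<^sup>2 = q\<close>.\<close>

section \<open>Finite fields and finite groups\<close>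

text \<open>Repackaging the type as an algebraic structure \<open>K\<close> makes the cyclicity of
  the multiplicative group of a finite field available.\<close>

lemma finite_field_generator:
  "\<exists>g::'a::{field,finite}. g \<noteq> 0 \<and> UNIV - {0} = {g ^ i |i::nat. True}"
proof -
  define K :: "'a ring" where
    "K = \<lparr>carrier = UNIV, monoid.mult = (*), one = 1, ring.zero = 0, add = (+)\<rparr>"
  have "\<exists>y. x + y = 0" for x :: 'a
    using add.right_inverse by blast
  moreover have "x \<noteq> 0 \<Longrightarrow> \<exists>y. x * y = 1" for x :: 'a
    by (rule exI[of _ "inverse x"]) auto
  ultimately have "field K"
    unfolding K_def using add.right_inverse
    by unfold_locales (auto simp: algebra_simps Units_def)
  then interpret K: field K .
  have pow: "a [^]\<^bsub>K\<^esub> i = a ^ i" for a and i :: nat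
    by (induction i) (simp_all add: K_def)
  have carrier: "carrier (mult_of K) = UNIV - {0}" "finite (carrier K)"
    by (simp_all add: K_def)
  show ?thesis
    using K.finite_field_mult_group_has_gen[OF carrier(2)] unfolding carrier(1) pow
    by auto
qed

text \<open>Multiplication by \<open>\<xi>\<close> permutes the subgroup, so it leaves the product of its elements
  unchanged.\<close>

lemma cyclic_unit_subgroup_power_card:
  assumes "\<xi> dvd 1"
  shows "\<xi> ^ card {\<xi> ^ i |i::nat. True} = (1 :: 'r::{comm_ring_1,finite})"
proof -
  define C where "C = {\<xi> ^ i |i::nat. True}"
  obtain \<eta> where \<eta>: "1 = \<xi> * \<eta>"
    using assms by (rule dvdE)
  have inj: "inj ((*) \<xi>)"
  proof (rule injI)
    fix x y assume "\<xi> * x = \<xi> * y"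
    hence "(\<xi> * \<eta>) * x = (\<xi> * \<eta>) * y" by (simp add: ac_simps)
    thus "x = y" by (simp flip: \<eta>)
  qed
  have "(*) \<xi> ` C \<subseteq> C"
    unfolding C_def by (auto intro: power_Suc[symmetric])
  hence image: "(*) \<xi> ` C = C"
    by (intro endo_inj_surj inj_on_subset[OF inj]) auto
  have "\<Prod>C * 1 = (\<Prod>y\<in>(*) \<xi> ` C. y)"
    by (simp add: image)
  also have "\<dots> = (\<Prod>y\<in>C. \<xi> * y)"
    by (subst prod.reindex) (auto intro: inj_on_subset[OF inj])
  also have "\<dots> = \<Prod>C * \<xi> ^ card C"
    by (simp add: prod.distrib mult.commute)
  finally have eq: "\<Prod>C * 1 = \<Prod>C * \<xi> ^ card C" .
  \<comment> \<open>The ring may have zero divisors, so cancelling \<open>\<Prod>C\<close> needs an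
    explicit inverse, built from powers of \<open>\<eta>\<close>.\<close>
  have "\<Prod>C * (\<Prod>y\<in>C. \<eta> ^ (SOME i. y = \<xi> ^ i)) = (\<Prod>y\<in>C. 1)"
    unfolding prod.distrib[symmetric]
  proof (rule prod.cong)
    fix y assume "y \<in> C"
    then obtain i where "y = \<xi> ^ i" unfolding C_def by blast
    hence "y = \<xi> ^ (SOME i. y = \<xi> ^ i)" by (rule someI)
    hence "y * \<eta> ^ (SOME i. y = \<xi> ^ i) = (\<xi> * \<eta>) ^ (SOME i. y = \<xi> ^ i)"
      by (metis power_mult_distrib)
    thus "y * \<eta> ^ (SOME i. y = \<xi> ^ i) = 1"
      by (simp flip: \<eta>)
  qed simp
  hence "\<exists>z. z * \<Prod>C = 1"
    by (auto simp: mult.commute[of _ "\<Prod>C"])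
  then obtain z where "z * \<Prod>C = 1" ..
  hence "\<xi> ^ card C = 1"
    using arg_cong[OF eq, of "(*) z"] by (simp flip: mult.assoc)
  thus ?thesis unfolding C_def .
qed

lemma finite_field_power_card:
  fixes x :: "'a::{field,finite}"
  shows "x ^ CARD('a) = x"
proof -
  obtain g :: 'a where g: "g \<noteq> 0" "UNIV - {0} = {g ^ i |i::nat. True}"
    using finite_field_generator by blast
  have order: "g ^ card (UNIV - {0 :: 'a}) = 1"
    unfolding g(2) using g(1) by (intro cyclic_unit_subgroup_power_card) (simp add: dvd_field_iff)
  have "CARD('a) = Suc (card (UNIV - {0 :: 'a}))"
    by (rule card_Suc_Diff1[symmetric]) simp_all
  hence gen: "g ^ CARD('a) = g"
    by (simp only: power_Suc order mult_1_right)
  show ?thesis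
  proof (cases "x = 0")
    case False
    then obtain i where "x = g ^ i"
      using g(2) by blast
    thus ?thesis
      using gen by (simp add: mult.commute[of i] power_mult flip: power_mult[of g i])
  qed simp
qed

text \<open>The nonempty fibres of \<open>h\<close> are the translates of its kernel.\<close>

lemma card_range_times_card_kernel:
  fixes h :: "'g::{ab_group_add,finite} \<Rightarrow> 'h::ab_group_add"
  assumes add: "\<And>x y. h (x + y) = h x + h y"
  shows "CARD('g) = card (range h) * card {x. h x = 0}"
proof -
  have diff: "h (x - y) = h x - h y" for x y
    using add[of "x - y" y] by simp
  have fibre: "card (h -` {y}) = card {x. h x = 0}" if "y \<in> range h" for y
  proof -
    from that obtain x where x: "y = h x" by blast
    have "bij_betw ((+) x) {x. h x = 0} (h -` {y})"
      by (rule bij_betw_byWitness[where f' = "\<lambda>z. z - x"]) (auto simp: x add diff)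
    thus ?thesis by (metis bij_betw_same_card)
  qed
  have "CARD('g) = card (\<Union>y\<in>range h. h -` {y})"
    by (rule arg_cong[where f = card]) auto
  also have "\<dots> = (\<Sum>y\<in>range h. card (h -` {y}))"
    by (rule card_UN_disjoint) auto
  also have "\<dots> = card (range h) * card {x. h x = 0}"
    using fibre by simp
  finally show ?thesis .
qed


section \<open>Teichmueller representatives\<close>

locale galois_ring_residue =
  fixes r :: nat and \<pi> :: "'r::{comm_ring_1,finite} \<Rightarrow> 'a::{field,finite}"
  assumes card_field: "CARD('a) = 2 ^ r"
    and char_ring: "CHAR('r) = 4"
    and card_ring: "CARD('r) = 4 ^ r"
    and residue: "residue_map \<pi>"
begin

lemma res_one: "\<pi> 1 = 1" and res_add: "\<pi> (x + y) = \<pi> x + \<pi> y"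
  and res_mult: "\<pi> (x * y) = \<pi> x * \<pi> y" and res_surj: "\<exists>x. \<pi> x = u"
  and res_eq_0_iff: "\<pi> x = 0 \<longleftrightarrow> (\<exists>z. x = 2 * z)"
  using residue unfolding residue_map_def surj_def by (auto, metis)

lemma res_zero: "\<pi> 0 = 0"
  by (rule res_eq_0_iff[THEN iffD2], rule exI[of _ 0]) simp

lemma res_diff: "\<pi> (x - y) = \<pi> x - \<pi> y"
  using res_add[of "x - y" y] by simp

lemma res_power: "\<pi> (x ^ n) = \<pi> x ^ n"
  by (induction n) (simp_all add: res_one res_mult)

lemma res_two: "\<pi> 2 = 0"
  by (rule res_eq_0_iff[THEN iffD2], rule exI[of _ 1]) simp

lemmas res_simps = res_zero res_one res_add res_mult res_diff res_power res_two

section \<open>Arithmetic of characteristic 2 in the residue field\<close>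

lemma two_eq_0: "(2 :: 'a) = 0"
  using res_add[of 1 1] by (simp add: res_simps)

lemma add_self: "x + x = (0 :: 'a)"
  by (simp add: two_eq_0 flip: mult_2)

lemma diff_eq_add: "x - y = x + (y :: 'a)"
  by (simp add: diff_eq_eq add.assoc add_self)

lemma add_self_left: "x + (x + y) = (y :: 'a)"
  by (simp add: add_self flip: add.assoc)

lemmas char_2_simps = diff_eq_add add_self add_self_left power2_eq_square
  distrib_left distrib_right ac_simps

lemma square_add: "(x + y)\<^sup>2 = x\<^sup>2 + (y :: 'a)\<^sup>2"
  by (simp add: power2_sum two_eq_0)

lemma frobenius_add: "(x + y) ^ (2 ^ i) = x ^ (2 ^ i) + (y :: 'a) ^ (2 ^ i)"
proof (induction i)
  case (Suc i)
  have "z ^ (2 ^ Suc i) = (z ^ (2 ^ i))\<^sup>2" for z :: 'a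
    by (simp only: power_Suc2 power_mult)
  thus ?case by (simp only: Suc square_add)
qed simp

lemma power_field_card: "x ^ (2 ^ r) = (x :: 'a)"
  using finite_field_power_card[of x] by (simp add: card_field)

lemma r_pos: "r > 0"
proof (rule ccontr)
  assume "\<not> r > 0"
  hence "CARD('a) = 1" by (simp add: card_field)
  moreover have "card {0, 1 :: 'a} \<le> CARD('a)"
    by (rule card_mono) auto
  ultimately show False by simp
qed

lemma double_power: "2 * 2 ^ (r - Suc 0) = (2 :: nat) ^ r"
  by (rule power_eq_if[THEN trans, symmetric]) (use r_pos in simp)

text \<open>The root is \<open>x ^ (2 ^ (r - 1))\<close>, because \<open>x ^ (2 ^ r) = x\<close>.
  Square roots bring arguments into the form in which lifts add with a known carry.\<close>

lemma obtain_square_root: obtains y :: 'a where "x = y\<^sup>2"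
proof
  show "x = (x ^ (2 ^ (r - 1)))\<^sup>2"
    by (simp add: power_field_card double_power mult.commute flip: power_mult)
qed

section \<open>The ideal generated by 2\<close>

lemma four_eq_0: "(4 :: 'r) = 0"
  using of_nat_CHAR[where 'a = 'r] by (simp add: char_ring)

lemma double_double: "2 * (2 * x) = (0 :: 'r)"
proof -
  have "2 * (2 * x) = 4 * x" by (simp flip: mult.assoc)
  thus ?thesis by (simp only: four_eq_0 mult_zero_left)
qed

text \<open>The kernel of \<open>\<pi>\<close> is the range of doubling and, as
  \<open>4 = 0\<close>, a subset of its kernel. Counting fibres of \<open>\<pi>\<close> and of
  doubling gives both kernels \<open>2 ^ r\<close> elements, so the inclusion is an
  equality.\<close>

lemma double_eq_0_iff: "2 * x = 0 \<longleftrightarrow> \<pi> x = 0"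
proof -
  have range2: "range ((*) (2 :: 'r)) = {x. \<pi> x = 0}"
    by (auto simp: res_eq_0_iff)
  have "surj \<pi>" unfolding surj_def using res_surj by metis
  hence "CARD('r) = CARD('a) * card {x. \<pi> x = 0}"
    using card_range_times_card_kernel[of \<pi>, OF res_add] by simp
  moreover have "(4 :: nat) ^ r = 2 ^ r * 2 ^ r"
    by (simp flip: power_mult_distrib)
  ultimately have ker: "card {x. \<pi> x = 0} = 2 ^ r"
    by (simp add: card_ring card_field)
  have "CARD('r) = card {x. \<pi> x = 0} * card {x::'r. 2 * x = 0}"
    using card_range_times_card_kernel[of "(*) (2 :: 'r)"] by (simp add: range2 distrib_left)
  hence "card {x::'r. 2 * x = 0} = 2 ^ r"
    using \<open>(4 :: nat) ^ r = 2 ^ r * 2 ^ r\<close> by (simp add: card_ring ker)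
  moreover have "{x. \<pi> x = 0} \<subseteq> {x. 2 * x = 0}"
    by (auto simp: res_eq_0_iff four_eq_0)
  ultimately have "{x. \<pi> x = 0} = {x. 2 * x = 0}"
    by (intro card_subset_eq) (auto simp: ker)
  thus ?thesis by blast
qed

text \<open>Reduces identities between doubled elements to identities in the residue field.\<close>

lemma double_eq_iff: "2 * x = 2 * y \<longleftrightarrow> \<pi> x = \<pi> y"
  using double_eq_0_iff[of "x - y"] by (simp add: right_diff_distrib res_simps)

text \<open>Squaring kills the ambiguity of representatives modulo 2, because
  \<open>(y + 2 z)\<^sup>2 = y\<^sup>2\<close> modulo 4.\<close>

lemma square_cong:
  assumes "\<pi> x = \<pi> y" shows "x\<^sup>2 = y\<^sup>2"
proof -
  have "\<pi> (x - y) = 0" using assms by (simp add: res_simps)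
  then obtain z where "x - y = 2 * z" by (auto simp: res_eq_0_iff)
  hence "x = y + 2 * z" by (simp add: algebra_simps)
  hence "x\<^sup>2 = y\<^sup>2 + 2 * (2 * (z\<^sup>2 + y * z))"
    by (simp add: power2_eq_square algebra_simps)
  thus ?thesis by (simp only: double_double add_0_right)
qed

text \<open>A working form of \<open>teich_lift\<close>, with which \<open>teich_lift_eq\<close>
  identifies it; by \<open>teich_res\<close> the choice of preimage is immaterial.\<close>

definition teich :: "'a \<Rightarrow> 'r"
  where "teich u = (SOME x. \<pi> x = u) ^ (2 ^ r)"

lemma teich_res: "teich (\<pi> x) = x ^ (2 ^ r)"
proof -
  define y where "y = (SOME y. \<pi> y = \<pi> x)"
  have "\<pi> y = \<pi> x" unfolding y_def by (rule someI) (rule refl)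
  hence "(y\<^sup>2) ^ (2 ^ (r - 1)) = (x\<^sup>2) ^ (2 ^ (r - 1))"
    by (rule arg_cong[OF square_cong])
  moreover have "(z\<^sup>2) ^ (2 ^ (r - 1)) = z ^ (2 ^ r)" for z :: 'r
    by (simp add: double_power flip: power_mult)
  ultimately show ?thesis unfolding teich_def y_def by simp
qed

lemma res_teich: "\<pi> (teich u) = u"
  using res_surj[of u] by (auto simp: teich_res res_simps power_field_card)

lemma teich_inj: "teich u = teich v \<longleftrightarrow> u = v"
  by (metis res_teich)

lemma teich_mult: "teich (u * v) = teich u * teich v"
proof -
  obtain x y where "u = \<pi> x" "v = \<pi> y" using res_surj by metis
  thus ?thesis by (simp add: teich_res power_mult_distrib flip: res_mult)
qed

lemma teich_one: "teich 1 = 1"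
  using teich_res[of 1] by (simp add: res_one)

lemma teich_zero: "teich 0 = 0"
  using teich_res[of 0] by (simp add: res_zero zero_power)

lemma teich_power: "teich (u ^ n) = teich u ^ n"
  by (induction n) (simp_all add: teich_one teich_mult)

lemma teich_res_square: "teich ((\<pi> x)\<^sup>2) = x\<^sup>2"
  unfolding teich_power by (rule square_cong) (rule res_teich)

text \<open>Both sides equal \<open>(teich u + teich v)\<^sup>2\<close>, since a square depends only
  on the residue of its root.\<close>

lemma teich_square_add: "teich ((u + v)\<^sup>2) = teich (u\<^sup>2) + teich (v\<^sup>2) + 2 * teich (u * v)"
proof -
  have "teich ((u + v)\<^sup>2) = (teich u + teich v)\<^sup>2"
    using teich_res_square[of "teich u + teich v"] by (simp add: res_simps res_teich)
  thus ?thesis by (simp add: power2_sum teich_power teich_mult)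
qed

text \<open>Lifting is additive modulo 2, and doubling sees nothing more.\<close>

lemma double_teich_add: "2 * teich (u + v) = 2 * teich u + 2 * teich v"
  by (simp only: double_eq_iff res_add res_teich flip: distrib_left)

lemma double_teich_sum: "2 * teich (\<Sum>i\<in>A. h i) = (\<Sum>i\<in>A. 2 * teich (h i))"
  by (induction A rule: infinite_finite_induct) (simp_all add: teich_zero double_teich_add)

text \<open>The 2-adic expansion with two digits: the first digit lifts the residue of
  \<open>x\<close>, and the cofactor of the remaining multiple of 2 matters only modulo 2.\<close>

lemma teich_decomposition: "\<exists>a b. x = teich a + 2 * teich b"
proof -
  have "\<pi> (x - teich (\<pi> x)) = 0" by (simp add: res_simps res_teich)
  then obtain z where "x - teich (\<pi> x) = 2 * z" by (auto simp: res_eq_0_iff)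
  moreover have "2 * z = 2 * teich (\<pi> z)" by (simp add: double_eq_iff res_teich)
  ultimately have "x = teich (\<pi> x) + 2 * teich (\<pi> z)" by (simp add: algebra_simps)
  thus ?thesis by blast
qed

lemma teich_decomposition_unique:
  "teich a + 2 * teich b = teich c + 2 * teich d \<longleftrightarrow> a = c \<and> b = d"
proof
  assume eq: "teich a + 2 * teich b = teich c + 2 * teich d"
  have "a = c" using arg_cong[OF eq, of \<pi>] by (simp add: res_simps res_teich)
  moreover from this eq have "b = d" by (simp add: double_eq_iff res_teich)
  ultimately show "a = c \<and> b = d" ..
qed simp

text \<open>For uniqueness, a generator \<open>\<xi>\<close> of any competing subgroup satisfies
  \<open>\<xi> ^ (2 ^ r) = \<xi>\<close>, so it is its own lift; this gives an inclusion of sets of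
  equal size.\<close>

lemma teich_group_eq: "teich_group r = teich ` (UNIV - {0})"
  unfolding teich_group_def
proof (rule the_equality)
  have card: "card (teich ` (UNIV - {0})) = 2 ^ r - 1"
    by (subst card_image) (auto simp: inj_on_def teich_inj card_field card_Diff_singleton)
  obtain g :: 'a where g: "g \<noteq> 0" "UNIV - {0} = {g ^ i |i::nat. True}"
    using finite_field_generator by blast
  have "teich g * teich (inverse g) = 1"
    using g(1) by (simp add: teich_one flip: teich_mult)
  hence "teich g dvd 1" by (metis dvd_triv_left)
  moreover have "teich ` (UNIV - {0}) = {teich g ^ i |i::nat. True}"
    unfolding g(2) by (auto simp: image_def teich_power)
  ultimately show "cyclic_unit_subgroup (teich ` (UNIV - {0})) \<and>
      card (teich ` (UNIV - {0})) = 2 ^ r - 1"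
    using card unfolding cyclic_unit_subgroup_def by blast
  fix C :: "'r set"
  assume C: "cyclic_unit_subgroup C \<and> card C = 2 ^ r - 1"
  then obtain \<xi> where \<xi>: "\<xi> dvd 1" "C = {\<xi> ^ i |i::nat. True}"
    unfolding cyclic_unit_subgroup_def by blast
  have "\<xi> ^ (2 ^ r - 1) = 1"
    using cyclic_unit_subgroup_power_card[OF \<xi>(1)] C \<xi>(2) by simp
  hence "\<xi> ^ Suc (2 ^ r - 1) = \<xi>" by (simp only: power_Suc mult_1_right)
  hence teich_\<xi>: "teich (\<pi> \<xi>) = \<xi>" by (simp add: teich_res)
  have "\<pi> \<xi> \<noteq> 0"
    using \<xi>(1) by (metis dvdE mult_zero_left res_mult res_one zero_neq_one)
  hence "\<xi> ^ i \<in> teich ` (UNIV - {0})" for i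
    using teich_\<xi> teich_power[of "\<pi> \<xi>" i] by (metis DiffI UNIV_I imageI power_not_zero singletonD)
  hence "C \<subseteq> teich ` (UNIV - {0})" unfolding \<xi>(2) by blast
  thus "C = teich ` (UNIV - {0})"
    using C card by (intro card_subset_eq) auto
qed

lemma teich_set_eq: "teich_set r = range teich"
  unfolding teich_set_def teich_group_eq using teich_zero by (metis UNIV_I image_insert insert_Diff insert_is_Un)

lemma teich_lift_eq: "teich_lift r \<pi> u = teich u"
  unfolding teich_lift_def teich_set_eq by (rule the_equality) (auto simp: res_teich)


section \<open>The trace\<close>

text \<open>The \<open>i\<close>-th power of the Frobenius automorphism of the Galois ring.\<close>

definition frob :: "nat \<Rightarrow> 'r \<Rightarrow> 'r"
  where "frob i x = (THE y. \<exists>a b. x = teich a + 2 * teich b \<and>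
    y = teich (a ^ (2 ^ i)) + 2 * teich (b ^ (2 ^ i)))"

lemma frob_teich:
  "frob i (teich a + 2 * teich b) = teich (a ^ (2 ^ i)) + 2 * teich (b ^ (2 ^ i))"
  unfolding frob_def by (rule the_equality) (auto simp: teich_decomposition_unique)

text \<open>With first digits written as squares, the digits of a sum are explicit: the carry
  \<open>u * v\<close> joins the second digit. Frobenius on the field respects sums and products,
  hence also the carry.\<close>

lemma frob_add: "frob i (x + y) = frob i x + frob i y"
proof -
  obtain a b c d where x: "x = teich a + 2 * teich b" and y: "y = teich c + 2 * teich d"
    using teich_decomposition by metis
  obtain s t where a: "a = s\<^sup>2" and c: "c = t\<^sup>2"
    using obtain_square_root by metis
  \<comment> \<open>The carry changes sides without changing sign because
    \<open>4 = 0\<close>.\<close>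
  have carry: "teich (u\<^sup>2) + teich (v\<^sup>2) = teich ((u + v)\<^sup>2) + 2 * teich (u * v)" for u v
    by (simp add: teich_square_add four_eq_0 flip: mult_2)
  have sum: "teich (u\<^sup>2) + 2 * teich b' + (teich (v\<^sup>2) + 2 * teich d') =
      teich ((u + v)\<^sup>2) + 2 * teich (u * v + b' + d')" for u v b' d'
    using carry[of u v] by (simp add: double_teich_add algebra_simps)
  have power: "(z\<^sup>2) ^ (2 ^ i) = (z ^ (2 ^ i))\<^sup>2" for z :: 'a
    by (simp add: mult.commute flip: power_mult)
  show ?thesis
    unfolding x y a c sum frob_teich power
    by (simp add: frobenius_add power_mult_distrib)
qed

lemma frob_sum: "frob i (\<Sum>k\<in>A. h k) = (\<Sum>k\<in>A. frob i (h k))"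
proof -
  have "frob i 0 = 0" using frob_add[of i 0 0] by simp
  thus ?thesis by (induction A rule: infinite_finite_induct) (simp_all add: frob_add)
qed

lemma frob_frob: "frob i (frob j x) = frob (i + j) x"
proof -
  obtain a b where "x = teich a + 2 * teich b" using teich_decomposition by metis
  thus ?thesis
    by (simp add: frob_teich power_add mult.commute flip: power_mult)
qed

lemma frob_r: "frob r x = frob 0 x"
proof -
  obtain a b where "x = teich a + 2 * teich b" using teich_decomposition by metis
  thus ?thesis by (simp add: frob_teich power_field_card)
qed

lemma gr_trace_eq: "gr_trace r x = (\<Sum>i<r. frob i x)"
proof -
  obtain a b where x: "x = teich a + 2 * teich b" using teich_decomposition by metis
  show ?thesis
    unfolding gr_trace_def teich_set_eq
    by (rule the_equality)
      (auto simp: x frob_teich teich_power teich_decomposition_unique)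
qed

lemma gr_trace_add: "gr_trace r (x + y) = gr_trace r x + gr_trace r (y :: 'r)"
  by (simp add: gr_trace_eq frob_add sum.distrib)

text \<open>Applying \<open>frob 1\<close> shifts the summands cyclically, so it fixes the trace.
  Both digits of a fixed element are idempotents of the field, hence 0 or 1.\<close>

lemma gr_trace_in_prime_subring: "\<exists>k::nat. gr_trace r x = of_nat k" for x :: 'r
proof -
  define y where "y = gr_trace r x"
  have "frob 1 y = (\<Sum>i<r. frob (Suc i) x)"
    by (simp add: y_def gr_trace_eq frob_sum frob_frob)
  also have "\<dots> = y"
    using sum.lessThan_Suc_shift[of "\<lambda>i. frob i x" r] frob_r[of x]
    by (simp add: y_def gr_trace_eq)
  finally have "frob 1 y = y" .
  moreover obtain a b where ab: "y = teich a + 2 * teich b" using teich_decomposition by metis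
  ultimately have "a\<^sup>2 = a" "b\<^sup>2 = b"
    by (simp_all add: frob_teich teich_decomposition_unique)
  hence "a = of_bool (a \<noteq> 0)" "b = of_bool (b \<noteq> 0)"
    by (auto simp: power2_eq_square)
  hence "teich a = of_nat (of_bool (a \<noteq> 0))" "teich b = of_nat (of_bool (b \<noteq> 0))"
    using teich_zero teich_one by (auto simp: of_bool_def split: if_splits)
  hence "y = of_nat (of_bool (a \<noteq> 0) + 2 * of_bool (b \<noteq> 0))"
    using ab by simp
  thus ?thesis unfolding y_def by blast
qed

lemma z4_rep_of_nat: "z4_rep (of_nat k :: 'r) = k mod 4"
  unfolding z4_rep_def
proof (rule the_equality)
  show "k mod 4 < 4 \<and> of_nat (k mod 4) = (of_nat k :: 'r)"
    by (simp add: of_nat_eq_iff_cong_CHAR char_ring cong_def)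
  show "j = k mod 4" if "j < 4 \<and> of_nat j = (of_nat k :: 'r)" for j
    using that by (auto simp: of_nat_eq_iff_cong_CHAR char_ring cong_def)
qed

text \<open>The trace of the residue field is a polynomial function of degree \<open>2 ^ (r - 1) < 2 ^ r\<close>.\<close>

lemma field_trace_nonzero: "\<exists>b::'a. (\<Sum>i<r. b ^ (2 ^ i)) \<noteq> 0"
proof (rule ccontr)
  define p :: "'a poly" where "p = (\<Sum>i<r. Polynomial.monom 1 (2 ^ i))"
  assume "\<not> ?thesis"
  hence "{x. poly p x = 0} = UNIV"
    by (auto simp: p_def poly_sum poly_monom)
  \<comment> \<open>Only \<open>i = 0\<close> yields the exponent 1, so the linear coefficient shows
    that \<open>p\<close> is nonzero.\<close>
  moreover have "Polynomial.coeff p 1 = (\<Sum>i<r. if i = 0 then 1 else 0)"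
    unfolding p_def coeff_sum by (intro sum.cong) auto
  hence "Polynomial.coeff p 1 = 1" using r_pos by simp
  hence "p \<noteq> 0" by auto
  moreover have "Polynomial.degree p \<le> 2 ^ (r - 1)"
    unfolding p_def by (rule degree_sum_le) (auto intro!: order.trans[OF degree_monom_le] power_increasing)
  ultimately have "CARD('a) \<le> 2 ^ (r - 1)"
    using card_poly_roots_bound[of p] by simp
  thus False using r_pos by (simp add: card_field)
qed

end


section \<open>The additive character\<close>

locale galois_ring_character = galois_ring_residue r \<pi>
  for r :: nat and \<pi> :: "'r::{comm_ring_1,finite} \<Rightarrow> 'a::{field,finite}" +
  fixes \<omega> :: complex
  assumes primitive: "primitive_root_unity 4 \<omega>"
begin

definition additive_char :: "'r \<Rightarrow> complex"
  where "additive_char x = \<omega> ^ z4_rep (gr_trace r x)"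

lemma root_power_mod: "\<omega> ^ (k mod 4) = \<omega> ^ k"
proof -
  have "\<omega> ^ k = (\<omega> ^ 4) ^ (k div 4) * \<omega> ^ (k mod 4)"
    by (simp flip: power_mult power_add)
  thus ?thesis using primitive by (simp add: primitive_root_unity_def)
qed

text \<open>Any natural number representing the trace may serve as exponent, so exponents can be
  added without reduction modulo 4.\<close>

lemma additive_char_of_trace: "gr_trace r x = of_nat k \<Longrightarrow> additive_char x = \<omega> ^ k"
  by (simp add: additive_char_def z4_rep_of_nat root_power_mod)

lemma additive_char_add: "additive_char (x + y) = additive_char x * additive_char y"
proof -
  obtain j k where jk: "gr_trace r x = of_nat j" "gr_trace r y = of_nat k"
    using gr_trace_in_prime_subring by metis
  hence "gr_trace r (x + y) = of_nat (j + k)" by (simp add: gr_trace_add)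
  thus ?thesis using jk by (simp only: additive_char_of_trace power_add)
qed

lemma additive_char_zero: "additive_char 0 = 1"
proof -
  have "gr_trace r (0 :: 'r) = of_nat 0" using gr_trace_add[of 0 0] by simp
  thus ?thesis by (simp only: additive_char_of_trace power_0)
qed

lemma norm_additive_char: "norm (additive_char x) = 1"
proof -
  have "norm \<omega> ^ 4 = 1"
    using primitive by (simp add: primitive_root_unity_def flip: norm_power)
  hence "norm \<omega> = 1" 
    using power_eq_imp_eq_base[of "norm \<omega>" 4 1] by simp
  thus ?thesis by (simp add: additive_char_def norm_power)
qed

lemma cnj_additive_char: "cnj (additive_char x) = additive_char (- x)"
proof -
  have "additive_char x * additive_char (- x) = 1"
    by (simp add: additive_char_zero flip: additive_char_add)
  moreover have "additive_char x * cnj (additive_char x) = 1"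
    by (simp add: complex_norm_square[symmetric] norm_additive_char)
  moreover have "additive_char x \<noteq> 0"
    using norm_additive_char[of x] by auto
  ultimately show ?thesis by (metis mult_left_cancel)
qed

text \<open>The trace of \<open>2 * teich b\<close> is twice the lift of the field trace of
  \<open>b\<close>, so it is nonzero once the field trace is.\<close>

lemma additive_char_nontrivial: "\<exists>b. additive_char (2 * teich b) \<noteq> 1"
proof -
  obtain b :: 'a where b: "(\<Sum>i<r. b ^ (2 ^ i)) \<noteq> 0"
    using field_trace_nonzero by blast
  have "frob i (2 * teich b) = 2 * teich (b ^ (2 ^ i))" for i
    using frob_teich[of i 0 b] by (simp add: teich_zero zero_power)
  hence "gr_trace r (2 * teich b) = 2 * teich (\<Sum>i<r. b ^ (2 ^ i))"
    by (simp add: gr_trace_eq double_teich_sum)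
  hence trace: "gr_trace r (2 * teich b) \<noteq> 0"
    using b by (simp add: double_eq_0_iff res_teich)
  obtain k where k: "gr_trace r (2 * teich b) = of_nat k"
    using gr_trace_in_prime_subring by blast
  hence "k mod 4 \<noteq> 0"
    using trace by (simp add: of_nat_eq_0_iff_char_dvd char_ring dvd_eq_mod_eq_0)
  hence "\<omega> ^ (k mod 4) \<noteq> 1"
    using primitive unfolding primitive_root_unity_def by simp
  thus ?thesis using k by (metis additive_char_of_trace root_power_mod)
qed

text \<open>Translating the summation variable by \<open>b\<close> multiplies the sum by a factor
  different from 1.\<close>

lemma additive_char_sum_eq_0: "(\<Sum>w\<in>UNIV. additive_char (2 * teich w)) = 0"
proof -
  obtain b where b: "additive_char (2 * teich b) \<noteq> 1"
    using additive_char_nontrivial by blast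
  define S where "S = (\<Sum>w\<in>UNIV. additive_char (2 * teich w))"
  have "S = (\<Sum>w\<in>UNIV. additive_char (2 * teich (b + w)))"
    unfolding S_def by (rule sum.reindex_bij_witness[of _ "\<lambda>w. b + w" "\<lambda>w. w - b"]) auto
  also have "\<dots> = additive_char (2 * teich b) * S"
    by (simp add: S_def double_teich_add additive_char_add sum_distrib_left)
  finally have "(1 - additive_char (2 * teich b)) * S = 0"
    by (simp add: left_diff_distrib)
  thus ?thesis using b unfolding S_def by simp
qed

text \<open>The form in which pseudo-planarity enters; with \<open>p = id\<close> it also gives
  orthogonality inside one basis.\<close>

lemma additive_char_sum_bij:
  assumes "bij p" and "c \<noteq> 0"
  shows "(\<Sum>w\<in>UNIV. additive_char (2 * teich (c * p w))) = 0"
proof -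
  have "bij (\<lambda>w. c * p w)"
    using bij_comp[OF assms(1), of "(*) c"] assms(2)
    by (simp add: o_def bij_betw_byWitness[where f' = "\<lambda>w. w / c"])
  from sum.reindex_bij_betw[OF this, of "\<lambda>w. additive_char (2 * teich w)"]
  show ?thesis by (simp add: additive_char_sum_eq_0)
qed

text \<open>The argument of the trace in \<open>mub_vec\<close>, brought into its two-digit
  expansion.\<close>

definition phase :: "('a \<Rightarrow> 'a) \<Rightarrow> 'a \<Rightarrow> 'a \<Rightarrow> 'a \<Rightarrow> 'r"
  where "phase f m v w = teich (m * w\<^sup>2) + 2 * teich (m * f w + v * w)"

lemma mub_vec_nth:
  "mub_vec r \<pi> \<omega> f m v $ w = additive_char (phase f m v w) / complex_of_real (sqrt (2 ^ r))"
proof -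
  have "teich m * ((teich w)\<^sup>2 + 2 * teich (f w)) + 2 * teich v * teich w = phase f m v w" for w
    by (simp add: phase_def teich_mult teich_power double_teich_add algebra_simps)
  thus ?thesis
    by (simp add: mub_vec_def teich_lift_eq additive_char_def[symmetric] axis_def sum_component
        card_field if_distrib cong: if_cong)
qed

section \<open>Inner products as character sums\<close>

lemma herm_mub_vec:
  "herm (mub_vec r \<pi> \<omega> f m v) (mub_vec r \<pi> \<omega> f m' v') =
     (\<Sum>w\<in>UNIV. additive_char (phase f m v w - phase f m' v' w)) / 2 ^ r"
proof -
  have "complex_of_real (sqrt (2 ^ r)) * complex_of_real (sqrt (2 ^ r)) = 2 ^ r"
    by (simp flip: of_real_mult)
  moreover have "additive_char x * cnj (additive_char y) = additive_char (x - y)" for x y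
    by (simp only: cnj_additive_char add_uminus_conv_diff flip: additive_char_add)
  ultimately show ?thesis
    by (simp add: herm_def mub_vec_nth sum_divide_distrib)
qed

text \<open>For equal \<open>m\<close> the quadratic parts cancel, leaving the sum of a linear
  character with coefficient \<open>v - v'\<close>.\<close>

lemma herm_mub_vec_same:
  "herm (mub_vec r \<pi> \<omega> f m v) (mub_vec r \<pi> \<omega> f m v') = (if v = v' then 1 else 0)"
proof (cases "v = v'")
  case True
  thus ?thesis by (simp add: herm_mub_vec additive_char_zero card_field)
next
  case False
  have "phase f m v w - phase f m v' w = 2 * teich ((v - v') * w)" for w
  proof -
    have "phase f m v w - phase f m v' w = 2 * (teich (m * f w + v * w) - teich (m * f w + v' * w))"
      by (simp add: phase_def right_diff_distrib)
    also have "\<dots> = 2 * teich ((v - v') * w)"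
      unfolding double_eq_iff by (simp add: res_simps res_teich left_diff_distrib)
    finally show ?thesis .
  qed
  thus ?thesis
    using False additive_char_sum_bij[of id "v - v'"] by (simp add: herm_mub_vec)
qed

text \<open>The leading coefficient is a square so that \<open>teich_square_add\<close> applies to
  \<open>s * w\<close> and \<open>s * a\<close>; its carry is \<open>s\<^sup>2 * (a * w)\<close>.
  The terms with \<open>c\<close> and \<open>d\<close> leave room for what the difference of two
  phases produces.\<close>

lemma norm_quadratic_sum:
  fixes c d s :: 'a
  assumes f: "pseudo_planar f" and s: "s \<noteq> 0"
  defines "G \<equiv> \<lambda>w. teich (s\<^sup>2 * w\<^sup>2) + 2 * teich (c * w\<^sup>2 + s\<^sup>2 * f w + d * w)"
  shows "(cmod (\<Sum>w\<in>UNIV. additive_char (G w)))\<^sup>2 = 2 ^ r"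
proof -
  define S where "S = (\<Sum>w\<in>UNIV. additive_char (G w))"
  \<comment> \<open>The first bracket does not depend on \<open>w\<close>; it becomes a constant
    factor in the sum \<open>inner\<close>.\<close>
  have G_shift: "G (w + a) - G w = (teich ((s * a)\<^sup>2) + 2 * teich (c * a\<^sup>2 + d * a))
      + 2 * teich (s\<^sup>2 * (f (w + a) + f w + a * w))" for w a
  proof -
    have "teich (s\<^sup>2 * (w + a)\<^sup>2) = teich ((s * w + s * a)\<^sup>2)"
      by (simp add: power_mult_distrib flip: distrib_left)
    also have "\<dots> = teich (s\<^sup>2 * w\<^sup>2) + teich ((s * a)\<^sup>2) + 2 * teich ((s * w) * (s * a))"
      by (simp add: teich_square_add power_mult_distrib)
    finally have "G (w + a) - G w = teich ((s * a)\<^sup>2) + 2 * (teich ((s * w) * (s * a))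
        + teich (c * (w + a)\<^sup>2 + s\<^sup>2 * f (w + a) + d * (w + a)) - teich (c * w\<^sup>2 + s\<^sup>2 * f w + d * w))"
      by (simp add: G_def algebra_simps)
    \<comment> \<open>Checked in the residue field, where the cross term of
      \<open>c * (w + a)\<^sup>2\<close> vanishes.\<close>
    also have "2 * (teich ((s * w) * (s * a))
        + teich (c * (w + a)\<^sup>2 + s\<^sup>2 * f (w + a) + d * (w + a)) - teich (c * w\<^sup>2 + s\<^sup>2 * f w + d * w))
      = 2 * (teich (c * a\<^sup>2 + d * a) + teich (s\<^sup>2 * (f (w + a) + f w + a * w)))"
      unfolding double_eq_iff
      by (simp add: res_simps res_teich char_2_simps)
    finally show ?thesis by (simp add: distrib_left add.assoc)
  qed
  have inner: "(\<Sum>w\<in>UNIV. additive_char (G (w + a) - G w)) = (if a = 0 then 2 ^ r else 0)" for a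
  proof (cases "a = 0")
    case False
    hence "bij (\<lambda>w. f (w + a) + f w + a * w)"
      using f by (simp add: pseudo_planar_def)
    from additive_char_sum_bij[OF this, of "s\<^sup>2"] show ?thesis
      using False s unfolding G_shift additive_char_add[of "_ + _"]
      by (simp flip: sum_distrib_left)
  qed (simp add: additive_char_zero card_field)
  have "complex_of_real ((cmod S)\<^sup>2) = S * cnj S"
    by (rule complex_norm_square)
  also have "\<dots> = (\<Sum>w\<in>UNIV. \<Sum>x\<in>UNIV. additive_char (G x - G w))"
    by (subst sum.swap)
      (simp add: S_def sum_product cnj_additive_char flip: additive_char_add)
  also have "\<dots> = (\<Sum>w\<in>UNIV. \<Sum>a\<in>UNIV. additive_char (G (w + a) - G w))"
  proof (rule sum.cong[OF refl])
    fix w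
    show "(\<Sum>x\<in>UNIV. additive_char (G x - G w)) = (\<Sum>a\<in>UNIV. additive_char (G (w + a) - G w))"
      by (rule sum.reindex_bij_witness[of _ "\<lambda>a. w + a" "\<lambda>x. x - w"]) auto
  qed
  also have "\<dots> = (\<Sum>a::'a\<in>UNIV. if a = 0 then 2 ^ r else 0)"
    by (subst sum.swap) (simp only: inner)
  also have "\<dots> = complex_of_real (2 ^ r)"
    by simp
  finally show ?thesis
    unfolding S_def by (simp only: of_real_eq_iff)
qed

text \<open>With \<open>m\<close> and \<open>m'\<close> written as squares, the difference of the
  phases again has the shape treated in \<open>norm_quadratic_sum\<close>, with \<open>s\<close> the
  sum of the roots.\<close>

lemma herm_mub_vec_distinct:
  assumes f: "pseudo_planar f" and "m \<noteq> m'"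
  shows "(cmod (herm (mub_vec r \<pi> \<omega> f m v) (mub_vec r \<pi> \<omega> f m' v')))\<^sup>2 = 1 / 2 ^ r"
proof -
  obtain \<mu> \<nu> where m: "m = \<mu>\<^sup>2" "m' = \<nu>\<^sup>2"
    using obtain_square_root by metis
  define s where "s = \<mu> + \<nu>"
  \<comment> \<open>In characteristic 2 the sum of the roots is their difference.\<close>
  have s: "s \<noteq> 0"
    using \<open>m \<noteq> m'\<close> by (auto simp: s_def m simp flip: diff_eq_add)
  have "phase f m v w - phase f m' v' w =
      teich (s\<^sup>2 * w\<^sup>2) + 2 * teich ((\<nu>\<^sup>2 + \<mu> * \<nu>) * w\<^sup>2 + s\<^sup>2 * f w + (v + v') * w)" for w
  proof -
    have "teich (s\<^sup>2 * w\<^sup>2) = teich ((\<mu> * w + \<nu> * w)\<^sup>2)"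
      by (simp add: s_def power_mult_distrib flip: distrib_right)
    also have "\<dots> = teich (m * w\<^sup>2) + teich (m' * w\<^sup>2) + 2 * teich ((\<mu> * w) * (\<nu> * w))"
      by (simp add: teich_square_add power_mult_distrib m)
    \<comment> \<open>Subtracting the lift of \<open>m' * w\<^sup>2\<close> rather than adding it
      costs twice that lift, and the carry costs twice the lift of
      \<open>\<mu> * \<nu> * w\<^sup>2\<close>; together they give the coefficient
      \<open>\<nu>\<^sup>2 + \<mu> * \<nu>\<close>.\<close>
    finally have "phase f m v w - phase f m' v' w = teich (s\<^sup>2 * w\<^sup>2) + 2 * (teich (m * f w + v * w)
        - teich (m' * f w + v' * w) - teich (m' * w\<^sup>2) - teich ((\<mu> * w) * (\<nu> * w)))"
      by (simp add: phase_def algebra_simps)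
    also have "2 * (teich (m * f w + v * w)
        - teich (m' * f w + v' * w) - teich (m' * w\<^sup>2) - teich ((\<mu> * w) * (\<nu> * w)))
      = 2 * teich ((\<nu>\<^sup>2 + \<mu> * \<nu>) * w\<^sup>2 + s\<^sup>2 * f w + (v + v') * w)"
      unfolding double_eq_iff
      by (simp add: res_simps res_teich s_def m char_2_simps)
    finally show ?thesis .
  qed
  thus ?thesis
    using norm_quadratic_sum[OF f s, of "\<nu>\<^sup>2 + \<mu> * \<nu>" "v + v'"]
    by (simp add: herm_mub_vec norm_divide norm_power power_divide power2_eq_square)
qed

text \<open>Every entry of \<open>mub_vec\<close> has modulus
  \<open>1 / sqrt (2 ^ r)\<close>.\<close>

lemma herm_axis_mub_vec:
  "(cmod (herm (axis w 1) (mub_vec r \<pi> \<omega> f m v)))\<^sup>2 = 1 / 2 ^ r"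
proof -
  have "herm (axis w 1) x = cnj (x $ w)" for x :: "complex ^ ('a::{field,finite})"
    by (simp add: herm_def axis_def if_distrib[of "\<lambda>z. z * _"] cong: if_cong)
  thus ?thesis
    by (simp add: mub_vec_nth norm_divide norm_additive_char power_divide)
qed

end


section \<open>Orthonormal bases\<close>

lemma herm_commute: "herm y x = cnj (herm x y)"
  by (simp add: herm_def mult.commute)

text \<open>Pairing a linear relation with \<open>y\<close> isolates the coefficient of
  \<open>y\<close>, so the vectors are independent; their number forces them to span.\<close>

lemma orthonormal_basisI:
  fixes B :: "(complex ^ 'n) set"
  assumes orth: "\<And>x y. x \<in> B \<Longrightarrow> y \<in> B \<Longrightarrow> herm x y = (if x = y then 1 else 0)"
    and card: "card B = CARD('n)"
  shows "orthonormal_basis B"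
proof -
  have fin: "finite B"
    using card by (intro card_ge_0_finite) simp
  have "vec.independent B"
    unfolding vec.dependent_finite[OF fin]
  proof (safe)
    fix u y assume y: "y \<in> B" "u y \<noteq> 0" and "(\<Sum>x\<in>B. u x *s x) = 0"
    hence "0 = herm (\<Sum>x\<in>B. u x *s x) y"
      by (simp add: herm_def)
    also have "\<dots> = (\<Sum>x\<in>B. u x * herm x y)"
      by (simp add: herm_def sum_component sum_distrib_left sum_distrib_right mult.assoc sum.swap[of _ B])
    also have "\<dots> = (\<Sum>x\<in>B. if x = y then u x else 0)"
      using y(1) by (intro sum.cong) (auto simp: orth)
    also have "\<dots> = u y"
      using fin y(1) by simp
    finally show False using y(2) by simp
  qed
  moreover have "vec.dim (UNIV :: (complex ^ 'n) set) \<le> card B"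
    by (simp only: vec_dim_card card)
  ultimately have "vec.span B = UNIV"
    using vec.card_ge_dim_independent[of B UNIV] by blast
  thus ?thesis
    using orth by (auto simp: orthonormal_basis_def)
qed

theorem theorem5p1:
  fixes r :: nat
    and f :: "'a::{field,finite} \<Rightarrow> 'a"
    and \<pi> :: "'r::{comm_ring_1,finite} \<Rightarrow> 'a"
    and \<omega> :: complex
  assumes "CARD('a) = 2 ^ r"
    and "pseudo_planar f"
    and "galois_ring_4 TYPE('r) r"
    and "residue_map \<pi>"
    and "primitive_root_unity 4 \<omega>"
  shows "complete_mubs (insert basis_inf {mub_basis r \<pi> \<omega> f m |m. True})"
proof -
  interpret galois_ring_character r \<pi> \<omega>
    using assms by unfold_locales (auto simp: galois_ring_4_def)
  define b where "b = mub_vec r \<pi> \<omega> f"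
  have basis: "mub_basis r \<pi> \<omega> f m = range (b m)" for m
    by (auto simp: mub_basis_def b_def)
  have basis_inf: "basis_inf = range (\<lambda>w::'a. axis w (1 :: complex))"
    by (auto simp: basis_inf_def)
  have herm_axis: "herm (axis w 1) (axis w' 1) = (if w = w' then 1 else 0)" for w w' :: 'a
    by (simp add: herm_def axis_def if_distrib[of "\<lambda>z. z * _"] cong: if_cong)
  have inj: "inj (b m)" for m
    by (rule injI) (metis b_def herm_mub_vec_same zero_neq_one)
  have inj_axis: "inj (\<lambda>w::'a. axis w (1 :: complex))"
    by (rule injI) (simp add: axis_eq_axis)
  have onb: "orthonormal_basis (range (b m))" for m
  proof (rule orthonormal_basisI)
    show "herm x y = (if x = y then 1 else 0)" if "x \<in> range (b m)" "y \<in> range (b m)" for x y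
      using that by (auto simp: b_def herm_mub_vec_same)
  qed (rule card_image[OF inj])
  have onb_inf: "orthonormal_basis (basis_inf :: (complex ^ ('a::{field,finite})) set)"
    unfolding basis_inf
    by (rule orthonormal_basisI) (auto simp: card_image[OF inj_axis] herm_axis axis_eq_axis)
  have unbiased: "(cmod (herm (b m v) (b m' v')))\<^sup>2 = 1 / 2 ^ r" if "m \<noteq> m'" for m m' v v'
    unfolding b_def by (rule herm_mub_vec_distinct[OF assms(2) that])
  have unbiased_inf: "(cmod (herm (axis w 1) (b m v)))\<^sup>2 = 1 / 2 ^ r"
    "(cmod (herm (b m v) (axis w 1)))\<^sup>2 = 1 / 2 ^ r" for m v w
    using herm_axis_mub_vec[of w f m v] herm_commute[of "b m v" "axis w 1"]
    by (simp_all add: b_def)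
  \<comment> \<open>Separates the bases: a vector common to two of them would have squared inner
    product with itself both 1 and \<open>1 / 2 ^ r\<close>. Their distinctness is what the count of
    bases needs.\<close>
  have q: "1 / 2 ^ r \<noteq> (1 :: real)"
    using one_less_power[of "2 :: real", OF _ r_pos] by simp
  have "range (b m) \<noteq> range (b m')" if "m \<noteq> m'" for m m'
  proof
    assume "range (b m) = range (b m')"
    then obtain v where "b m 0 = b m' v" by (metis rangeE rangeI)
    thus False
      using unbiased[OF that, of 0 v] herm_mub_vec_same[of f m' v v] q by (simp add: b_def)
  qed
  hence inj_basis: "inj (\<lambda>m. range (b m))"
    unfolding inj_def by blast
  have "range (b m) \<noteq> basis_inf" for m
  proof
    assume "range (b m) = basis_inf"
    then obtain w where "b m 0 = axis w 1" unfolding basis_inf by (metis rangeE rangeI)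
    thus False
      using unbiased_inf(1)[of w m 0] herm_axis[of w w] q by simp
  qed
  hence "card (insert basis_inf (range (\<lambda>m. range (b m)))) = CARD('a) + 1"
    by (subst card_insert_disjoint) (auto simp: card_image[OF inj_basis])
  moreover have "(cmod (herm x y))\<^sup>2 = 1 / 2 ^ r"
    if B: "B \<in> insert basis_inf (range (\<lambda>m. range (b m)))"
      "B' \<in> insert basis_inf (range (\<lambda>m. range (b m)))" "B \<noteq> B'" and xy: "x \<in> B" "y \<in> B'" for B B' x y
  proof -
    consider "B = basis_inf" "B' = basis_inf" | m where "B = basis_inf" "B' = range (b m)"
      | m where "B = range (b m)" "B' = basis_inf"
      | m m' where "B = range (b m)" "B' = range (b m')"
      using B(1,2) by blast
    thus ?thesis
    proof cases
      case 4
      moreover from this have "m \<noteq> m'" using B(3) by blast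
      ultimately show ?thesis using xy unbiased by blast
    qed (use B(3) xy unbiased_inf in \<open>auto simp: basis_inf\<close>)
  qed
  moreover have "{mub_basis r \<pi> \<omega> f m |m. True} = range (\<lambda>m. range (b m))"
    by (auto simp: basis)
  ultimately show ?thesis
    unfolding complete_mubs_def using onb onb_inf
    by (auto simp: card_field)
qed

end
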